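(* For each integer $n\ge 0$, let $GG_2(n)$ denote the number of partitions of $n$ in which any two parts differ by at least $2$, no part is less than $3$, and no two consecutive even numbers (that is, $2s$ and $2s-2$ for some integer $s$) both appear as parts. Let $\overline{GG_2}(n)$ denote the number of overpartitions of $n$ in which the non-overlined parts are odd, distinct and greater than $1$, and the overlined parts are odd and each at most $2r-1$, where $r$ is the number of non-overlined parts. Then $GG_2(n)=\overline{GG_2}(n)$ for every $n\ge 0$.
   Context: A partition of $n$ is a weakly decreasing finite sequence of positive integers (its parts) with sum $n$; parts at different positions count as different parts, so "differ by at least $2$" excludes repeated parts. An overpartition of $n$ is a weakly decreasing finite sequence of positive integers with sum $n$ in which the last occurrence of a part of each given magnitude may or may not be overlined. Thus the overlined parts are automatically distinct from one another. "The non-overlined parts are distinct" means that they are pairwise distinct among themselves; an overlined and a non-overlined part may have the same magnitude. Conditions on parts of a given kind are vacuous if there are no such parts; if $r=0$ the bound $2r-1=-1$ means there are no overlined parts. There is exactly one partition and one overpartition of $0$ (the empty one). *)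

theory Defs
imports Main
begin

definition is_partition :: "nat \<Rightarrow> nat list \<Rightarrow> bool" where
  "is_partition n xs \<longleftrightarrow>
     sorted_wrt (\<ge>) xs \<and> (\<forall>x\<in>set xs. 0 < x) \<and> sum_list xs = n"

(* An entry (k, b) is a part of magnitude k, overlined iff b. Since the magnitudes
   are sorted, the last conjunct says that an overlined entry is the last
   occurrence of its magnitude. *)
definition is_overpartition :: "nat \<Rightarrow> (nat \<times> bool) list \<Rightarrow> bool" where
  "is_overpartition n ps \<longleftrightarrow>
     is_partition n (map fst ps) \<and>
     (\<forall>i<length ps. snd (ps ! i) \<longrightarrow>
        (\<forall>j. i < j \<and> j < length ps \<longrightarrow> fst (ps ! j) \<noteq> fst (ps ! i)))"

definition overlined :: "(nat \<times> bool) list \<Rightarrow> nat list" where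
  "overlined ps = map fst (filter (\<lambda>p. snd p) ps)"

definition non_overlined :: "(nat \<times> bool) list \<Rightarrow> nat list" where
  "non_overlined ps = map fst (filter (\<lambda>p. \<not> snd p) ps)"

definition GG2_partitions :: "nat \<Rightarrow> nat list set" where
  "GG2_partitions n = {xs. is_partition n xs \<and>
     (\<forall>i<length xs. \<forall>j<length xs. i \<noteq> j \<longrightarrow> \<bar>int (xs ! i) - int (xs ! j)\<bar> \<ge> 2) \<and>
     (\<forall>x\<in>set xs. 3 \<le> x) \<and>
     \<not> (\<exists>s::int. 2 * s \<in> int ` set xs \<and> 2 * s - 2 \<in> int ` set xs)}"

(* The bound 2 r - 1 is taken in the integers, so it is -1 for r = 0. *)
definition GG2_overpartitions :: "nat \<Rightarrow> (nat \<times> bool) list set" where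
  "GG2_overpartitions n = {ps. is_overpartition n ps \<and>
     (\<forall>x\<in>set (non_overlined ps). odd x \<and> 1 < x) \<and>
     distinct (non_overlined ps) \<and>
     (\<forall>x\<in>set (overlined ps).
        odd x \<and> int x \<le> 2 * int (length (non_overlined ps)) - 1)}"

definition GG2 :: "nat \<Rightarrow> nat" where
  "GG2 n = card (GG2_partitions n)"

definition GG2_bar :: "nat \<Rightarrow> nat" where
  "GG2_bar n = card (GG2_overpartitions n)"

(* The sets being counted are finite, so card is their true cardinality. *)

lemma partition_bounds:
  assumes "is_partition n xs"
  shows "set xs \<subseteq> {..n}" "length xs \<le> n"
proof -
  have *: "(\<forall>x\<in>set xs. 0 < x) \<Longrightarrow> length xs \<le> sum_list xs" for xs :: "nat list"
    by (induction xs) auto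
  show "length xs \<le> n"
    using assms *[of xs] by (auto simp: is_partition_def)
  show "set xs \<subseteq> {..n}"
    using assms member_le_sum_list by (auto simp: is_partition_def)
qed

lemma finite_GG2_partitions: "finite (GG2_partitions n)"
  by (rule finite_subset[OF _ finite_lists_length_le[of "{..n}" n]])
     (use partition_bounds in \<open>auto simp: GG2_partitions_def\<close>)

lemma finite_GG2_overpartitions: "finite (GG2_overpartitions n)"
proof (rule finite_subset[OF _ finite_lists_length_le[of "{..n} \<times> UNIV" n]])
  show "GG2_overpartitions n \<subseteq> {ps. set ps \<subseteq> {..n} \<times> UNIV \<and> length ps \<le> n}"
  proof
    fix ps assume "ps \<in> GG2_overpartitions n"
    then have "is_partition n (map fst ps)"
      by (simp add: GG2_overpartitions_def is_overpartition_def)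
    from partition_bounds[OF this]
    show "ps \<in> {ps. set ps \<subseteq> {..n} \<times> UNIV \<and> length ps \<le> n}" by auto
  qed
qed simp

end

theory Submission
imports Defs
begin

text \<open>
  Both sides are refined by \<open>r\<close>, the number of parts of the partition, respectively the number of
  non-overlined parts of the overpartition. For each \<open>r\<close> the two refined counts agree, because both
  families are built up by the same recursion on the smallest relevant part.

  A partition counted by \<open>GG\<^sub>2\<close> is a finite set of integers. If its smallest part is at least 5,
  subtract 2 from every part. If the smallest part is 3, the others are at least 5: delete the 3 and
  subtract 2 from the others. If the smallest part is 4, the others are at least 7, since 6 would
  be the next even number: delete the 4 and subtract 4 from the others. These moves are reversible
  and never disturb the conditions, as they shift all parts by the same even number.

  An overpartition counted by the other side is a pair of a set \<open>N\<close> of \<open>r\<close> odd numbers, each at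
  least 3, and a set \<open>V\<close> of odd numbers below \<open>2r\<close>. If \<open>3 \<notin> N\<close>, subtract 2 from the elements
  of \<open>N\<close>. Otherwise delete the 3, subtract 2 from the others, and also delete \<open>2r - 1\<close> from
  \<open>V\<close> if it is there, because that number exceeds the bound that goes with \<open>r - 1\<close>.

  Going from \<open>r + 1\<close> down, the three cases lose the weights \<open>2r + 2\<close>, \<open>2r + 3\<close> and \<open>4r + 4\<close> on
  both sides (for the third: \<open>4 + 4r\<close> on the one, \<open>(3 + 2r) + (2r + 1)\<close> on the other), so
  \<open>card_level_eq_rec_count\<close> gives both counts the same value (\<open>card_gap_sets\<close>,
  \<open>card_odd_pairs\<close>). The lists of the two definitions are then identified with sets by the
  uniqueness of a strictly decreasing enumeration.
\<close>

section \<open>Counting a graded family with a three-term recursion\<close>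

text \<open>
  The coefficient of \<open>q\<close> to the \<open>n\<close> in the product of \<open>q ^ (2 * i + 1) * (1 + q ^ (2 * i - 1)) /
  (1 - q ^ (2 * i))\<close> over \<open>i = 1, \<dots>, r\<close>: the first summand of the recursion comes from clearing
  the denominator of the last factor, the other two from expanding its numerator.
\<close>

fun rec_count :: "nat \<Rightarrow> nat \<Rightarrow> nat" where
  "rec_count 0 n = (if n = 0 then 1 else 0)"
| "rec_count (Suc r) n =
     (if 2 * r + 2 \<le> n then rec_count (Suc r) (n - (2 * r + 2)) else 0)
   + (if 2 * r + 3 \<le> n then rec_count r (n - (2 * r + 3)) else 0)
   + (if 4 * r + 4 \<le> n then rec_count r (n - (4 * r + 4)) else 0)"

text \<open>
  A family whose level \<open>r + 1\<close> is the disjoint union of three injective images has its weight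
  distribution determined by the weights which the three maps add. The first map starts from level
  \<open>r + 1\<close> itself, but adds a positive weight, so that the induction is well-founded.
  Finiteness is proved along with the count, since the cardinality of the union needs it.
\<close>

lemma card_level_eq_rec_count:
  fixes X :: "nat \<Rightarrow> 'a set" and w :: "'a \<Rightarrow> nat"
  assumes base: "X 0 = {e}" "w e = 0"
    and step: "\<And>r. X (Suc r) = f ` X (Suc r) \<union> g ` X r \<union> h r ` X r"
    and disjoint: "\<And>r. f ` X (Suc r) \<inter> g ` X r = {}"
      "\<And>r. f ` X (Suc r) \<inter> h r ` X r = {}" "\<And>r. g ` X r \<inter> h r ` X r = {}"
    and inj: "\<And>r. inj_on f (X r)" "\<And>r. inj_on g (X r)" "\<And>r. inj_on (h r) (X r)"
    and weight: "\<And>r x. x \<in> X (Suc r) \<Longrightarrow> w (f x) = w x + (2 * r + 2)"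
      "\<And>r x. x \<in> X r \<Longrightarrow> w (g x) = w x + (2 * r + 3)"
      "\<And>r x. x \<in> X r \<Longrightarrow> w (h r x) = w x + (4 * r + 4)"
  shows "finite {x \<in> X r. w x = n} \<and> card {x \<in> X r. w x = n} = rec_count r n"
proof (induction r n rule: rec_count.induct)
  case (1 n)
  have "{x \<in> X 0. w x = n} = (if n = 0 then {e} else {})"
    using base by auto
  then show ?case by simp
next
  case (2 r n)
  have shifted: "finite {x \<in> X s. w x + d = n} \<and>
      card {x \<in> X s. w x + d = n} = (if d \<le> n then rec_count s (n - d) else 0)"
    if "d \<le> n \<Longrightarrow> finite {x \<in> X s. w x = n - d} \<and> card {x \<in> X s. w x = n - d} = rec_count s (n - d)"
    for s d
  proof (cases "d \<le> n")
    case True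
    then have "{x \<in> X s. w x + d = n} = {x \<in> X s. w x = n - d}" by auto
    then show ?thesis using that True by simp
  next
    case False
    then have "{x \<in> X s. w x + d = n} = {}" by auto
    then show ?thesis using False by (simp only: finite.emptyI card.empty if_False simp_thms)
  qed
  define F where "F = {x \<in> X (Suc r). w x + (2 * r + 2) = n}"
  define G where "G = {x \<in> X r. w x + (2 * r + 3) = n}"
  define H where "H = {x \<in> X r. w x + (4 * r + 4) = n}"
  note counts = shifted[OF 2(1), folded F_def] shifted[OF 2(2), folded G_def]
    shifted[OF 2(3), folded H_def]
  have sub: "F \<subseteq> X (Suc r)" "G \<subseteq> X r" "H \<subseteq> X r"
    by (auto simp: F_def G_def H_def)
  have level: "{x \<in> X (Suc r). w x = n} = f ` F \<union> g ` G \<union> h r ` H"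
    (is "?L = ?R")
  proof
    show "?L \<subseteq> ?R"
    proof
      fix x assume x: "x \<in> ?L"
      then consider y where "y \<in> X (Suc r)" "x = f y" | y where "y \<in> X r" "x = g y"
        | y where "y \<in> X r" "x = h r y"
        using step[of r] by blast
      then show "x \<in> ?R"
        using x weight by cases (auto simp: F_def G_def H_def)
    qed
    have "?R \<subseteq> X (Suc r)"
      using sub by (subst step) blast
    then show "?R \<subseteq> ?L"
      using weight by (auto simp: F_def G_def H_def)
  qed
  have "card (f ` F \<union> g ` G \<union> h r ` H) = card (f ` F) + card (g ` G) + card (h r ` H)"
  proof -
    have fin: "finite (f ` F)" "finite (g ` G)" "finite (h r ` H)"
      using counts by auto
    have "f ` F \<inter> g ` G = {}" "(f ` F \<union> g ` G) \<inter> h r ` H = {}"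
      using sub disjoint[of r] by blast+
    then show ?thesis
      using fin by (simp only: card_Un_disjoint finite_Un simp_thms)
  qed
  also have "\<dots> = card F + card G + card H"
    using sub inj by (metis card_image inj_on_subset)
  finally show ?case
    using counts by (simp add: level rec_count.simps(2)[of r n] del: rec_count.simps)
qed

section \<open>The two families of sets\<close>

definition shift :: "nat \<Rightarrow> nat set \<Rightarrow> nat set" where
  "shift d S = (+) d ` S"

lemma mem_shift: "y \<in> shift d S \<longleftrightarrow> d \<le> y \<and> y - d \<in> S"
  unfolding shift_def image_iff by (metis add_diff_cancel_left' le_add1 le_add_diff_inverse)

lemma shift_exists: "S \<subseteq> {d..} \<Longrightarrow> \<exists>T. S = shift d T"
  by (rule exI[of _ "(\<lambda>x. x - d) ` S"]) (force simp: shift_def image_image)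

lemma shift_eq_iff: "shift d S = shift d T \<longleftrightarrow> S = T"
  by (simp add: shift_def inj_image_eq_iff)

lemma card_shift: "card (shift d S) = card S"
  unfolding shift_def by (intro card_image) simp

lemma sum_shift: "\<Sum>(shift d S) = \<Sum>S + d * card S"
  by (simp add: shift_def sum.reindex sum.distrib)

lemma finite_shift_iff: "finite (shift d S) \<longleftrightarrow> finite S"
  unfolding shift_def by (intro finite_image_iff) simp

text \<open>
  These sets stand for the partitions with \<open>r\<close> parts, and the pairs below for the overpartitions
  with \<open>r\<close> non-overlined parts, \<open>N\<close> holding the non-overlined and \<open>V\<close> the overlined parts. The bound
  \<open>x < 2 * r\<close> replaces \<open>x \<le> 2 * r - 1\<close> because subtraction would truncate for \<open>r = 0\<close>.
\<close>

definition gap_sets :: "nat \<Rightarrow> nat set set" where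
  "gap_sets r = {S. finite S \<and> card S = r \<and>
     (\<forall>x\<in>S. 3 \<le> x \<and> x + 1 \<notin> S \<and> (even x \<longrightarrow> x + 2 \<notin> S))}"

definition odd_pairs :: "nat \<Rightarrow> (nat set \<times> nat set) set" where
  "odd_pairs r = {(N, V). finite N \<and> card N = r \<and> (\<forall>x\<in>N. odd x \<and> 3 \<le> x) \<and>
     V \<subseteq> {x. odd x \<and> x < 2 * r}}"

text \<open>
  The recursion adds a smallest part 3 or 4 below a set shifted up by 2 or 4. A shift by 4 makes room
  for a part 4: the old parts become at least 7, hence avoid both 5 and the next even number 6.
\<close>

lemma card_gap_sets: "card {S \<in> gap_sets r. \<Sum>S = n} = rec_count r n"
proof -
  let ?f = "shift 2" and ?g = "\<lambda>S. insert 3 (shift 2 S)" and ?h = "\<lambda>S. insert 4 (shift 4 S)"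
  have ge3: "3 \<le> x" if "S \<in> gap_sets r" "x \<in> S" for S x r
    using that by (auto simp: gap_sets_def)
  have notin: "3 \<notin> shift 2 S" "4 \<notin> shift 2 S" "3 \<notin> shift 4 S" "4 \<notin> shift 4 S"
    if "S \<in> gap_sets r" for S r
    using ge3[OF that] by (fastforce simp: mem_shift)+
  have shifted: "d + 3 \<le> x \<and> x + 1 \<notin> shift d S \<and> (even x \<longrightarrow> x + 2 \<notin> shift d S)"
    if S: "S \<in> gap_sets r" and "even d" and "x \<in> shift d S" for S r d x
  proof -
    obtain y where y: "y \<in> S" "x = d + y"
      using \<open>x \<in> shift d S\<close> by (auto simp: shift_def)
    then have "3 \<le> y \<and> y + 1 \<notin> S \<and> (even y \<longrightarrow> y + 2 \<notin> S)"
      using S by (simp add: gap_sets_def)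
    then show ?thesis using y(2) \<open>even d\<close> by (simp add: mem_shift)
  qed
  have size: "finite (shift d S)" "card (shift d S) = r" if "S \<in> gap_sets r" for S r d
    using that by (simp_all add: gap_sets_def card_shift finite_shift_iff)
  have f_mem: "shift 2 S \<in> gap_sets r" if S: "S \<in> gap_sets r" for S r
  proof -
    have "3 \<le> x \<and> x + 1 \<notin> shift 2 S \<and> (even x \<longrightarrow> x + 2 \<notin> shift 2 S)" if "x \<in> shift 2 S" for x
      using shifted[OF S _ that] by auto
    then show ?thesis using size[OF S] by (simp add: gap_sets_def)
  qed
  have g_mem: "?g S \<in> gap_sets (Suc r)" if S: "S \<in> gap_sets r" for S r
  proof -
    have "3 \<le> x \<and> x + 1 \<notin> ?g S \<and> (even x \<longrightarrow> x + 2 \<notin> ?g S)" if "x \<in> ?g S" for x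
    proof (cases "x = 3")
      case True
      then show ?thesis using shifted[OF S, of 2 4] by auto
    next
      case False
      then have "x \<in> shift 2 S" using that by blast
      then show ?thesis using shifted[OF S, of 2 x] by auto
    qed
    moreover have "card (?g S) = Suc r"
      using size[OF S] notin[OF S] by simp
    ultimately show ?thesis using size(1)[OF S] by (simp add: gap_sets_def)
  qed
  have h_mem: "?h S \<in> gap_sets (Suc r)" if S: "S \<in> gap_sets r" for S r
  proof -
    have "3 \<le> x \<and> x + 1 \<notin> ?h S \<and> (even x \<longrightarrow> x + 2 \<notin> ?h S)" if "x \<in> ?h S" for x
    proof (cases "x = 4")
      case True
      then show ?thesis using shifted[OF S, of 4 5] shifted[OF S, of 4 6] by auto
    next
      case False
      then have "x \<in> shift 4 S" using that by blast
      then show ?thesis using shifted[OF S, of 4 x] by auto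
    qed
    moreover have "card (?h S) = Suc r"
      using size[OF S] notin[OF S] by simp
    ultimately show ?thesis using size(1)[OF S] by (simp add: gap_sets_def)
  qed
  have decompose: "S \<in> ?f ` gap_sets (Suc r) \<union> ?g ` gap_sets r \<union> ?h ` gap_sets r"
    if S: "S \<in> gap_sets (Suc r)" for S r
  proof -
    have fin: "finite S" and crd: "card S = Suc r" using S by (auto simp: gap_sets_def)
    have gaps: "3 \<le> x \<and> x + 1 \<notin> S \<and> (even x \<longrightarrow> x + 2 \<notin> S)" if "x \<in> S" for x
      using S that by (auto simp: gap_sets_def)
    \<comment> \<open>Undoing an even shift preserves the conditions on gaps, which depend only on parity and
      differences; the lower bound has to be supplied.\<close>
    have desc: "T \<in> gap_sets s"
      if sub: "shift d T \<subseteq> S" and "even d" and low: "shift d T \<subseteq> {d + 3..}"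
        and "card (shift d T) = s" for d T s
    proof -
      have "finite T" using finite_subset[OF sub fin] finite_shift_iff by blast
      moreover have "3 \<le> x \<and> x + 1 \<notin> T \<and> (even x \<longrightarrow> x + 2 \<notin> T)" if "x \<in> T" for x
      proof -
        have "d + x \<in> shift d T" using that by (simp add: mem_shift)
        then have "d + x \<in> S" "d + 3 \<le> d + x" using sub low by auto
        moreover have "d + x + k \<in> S" if "x + k \<in> T" for k
        proof -
          have "d + (x + k) \<in> shift d T" using that by (simp add: mem_shift)
          then show ?thesis using sub by (auto simp: add.assoc)
        qed
        from this[of 1] this[of 2] have "x + 1 \<in> T \<Longrightarrow> d + x + 1 \<in> S" "x + 2 \<in> T \<Longrightarrow> d + x + 2 \<in> S"
          by blast+
        ultimately show ?thesis using gaps[of "d + x"] \<open>even d\<close> by auto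
      qed
      ultimately show ?thesis using \<open>card (shift d T) = s\<close> by (simp add: gap_sets_def card_shift)
    qed
    consider "3 \<in> S" | "4 \<in> S" | "3 \<notin> S" "4 \<notin> S" by blast
    then show ?thesis
    proof cases
      case 1
      have low: "S - {3} \<subseteq> {2 + 3..}"
      proof
        fix x assume x: "x \<in> S - {3}"
        then have "x \<noteq> 4" using gaps[OF 1] by auto
        then show "x \<in> {2 + 3..}" using x gaps[of x] by auto
      qed
      then obtain T where T: "S - {3} = shift 2 T"
        using shift_exists[of "S - {3}" 2] by fastforce
      have "T \<in> gap_sets r"
        using desc[of 2 T r, folded T] low 1 fin crd by auto
      moreover have "S = ?g T" using T 1 by auto
      ultimately show ?thesis by blast
    next
      case 2
      have low: "S - {4} \<subseteq> {4 + 3..}"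
      proof
        fix x assume x: "x \<in> S - {4}"
        then have "x \<noteq> 3" using 2 gaps[of 3] by auto
        moreover have "x \<noteq> 5" "x \<noteq> 6" using x gaps[OF 2] by auto
        ultimately show "x \<in> {4 + 3..}" using x gaps[of x] by auto
      qed
      then obtain T where T: "S - {4} = shift 4 T"
        using shift_exists[of "S - {4}" 4] by fastforce
      have "T \<in> gap_sets r"
        using desc[of 4 T r, folded T] low 2 fin crd by auto
      moreover have "S = ?h T" using T 2 by auto
      ultimately show ?thesis by blast
    next
      case 3
      have low: "S \<subseteq> {2 + 3..}"
      proof
        fix x assume x: "x \<in> S"
        then have "x \<noteq> 3" "x \<noteq> 4" using 3 by auto
        then show "x \<in> {2 + 3..}" using gaps[OF x] by auto
      qed
      then obtain T where T: "S = shift 2 T"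
        using shift_exists[of S 2] by fastforce
      have "T \<in> gap_sets (Suc r)"
        using desc[of 2 T "Suc r", folded T] low crd by auto
      then show ?thesis using T by blast
    qed
  qed
  have "S = {}" if "S \<in> gap_sets 0" for S
    using size(2)[OF that, of 0] size(1)[OF that, of 0] by (simp add: card_shift finite_shift_iff)
  moreover have "{} \<in> gap_sets 0"
    by (simp add: gap_sets_def)
  ultimately have base: "gap_sets 0 = {{}}"
    by blast
  have step: "gap_sets (Suc r) = ?f ` gap_sets (Suc r) \<union> ?g ` gap_sets r \<union> ?h ` gap_sets r" for r
    by (intro equalityI subsetI decompose Un_least image_subsetI f_mem g_mem h_mem)
  have disj_fg: "?f ` gap_sets (Suc r) \<inter> ?g ` gap_sets r = {}" for r
    using notin by blast
  have disj_fh: "?f ` gap_sets (Suc r) \<inter> ?h ` gap_sets r = {}" for r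
    using notin by blast
  have "?g S \<noteq> ?h T" if T: "T \<in> gap_sets r" for S T r
  proof
    assume "?g S = ?h T"
    then have "3 \<in> ?h T" by (metis insertI1)
    then show False using notin(3)[OF T] by simp
  qed
  then have disj_gh: "?g ` gap_sets r \<inter> ?h ` gap_sets r = {}" for r
    by blast
  have inj_f: "inj_on ?f (gap_sets r)" for r
    by (simp add: inj_on_def shift_eq_iff)
  have inj_g: "inj_on ?g (gap_sets r)" for r
  proof (rule inj_onI)
    fix S T assume *: "S \<in> gap_sets r" "T \<in> gap_sets r" "?g S = ?g T"
    then have "shift 2 S = shift 2 T"
      using notin[OF *(1)] notin[OF *(2)] by (simp only: insert_ident not_False_eq_True)
    then show "S = T" by (simp only: shift_eq_iff)
  qed
  have inj_h: "inj_on ?h (gap_sets r)" for r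
  proof (rule inj_onI)
    fix S T assume *: "S \<in> gap_sets r" "T \<in> gap_sets r" "?h S = ?h T"
    then have "shift 4 S = shift 4 T"
      using notin[OF *(1)] notin[OF *(2)] by (simp only: insert_ident not_False_eq_True)
    then show "S = T" by (simp only: shift_eq_iff)
  qed
  have weight_f: "\<Sum>(?f S) = \<Sum>S + (2 * r + 2)" if "S \<in> gap_sets (Suc r)" for S r
    using that by (simp add: sum_shift gap_sets_def)
  have weight_g: "\<Sum>(?g S) = \<Sum>S + (2 * r + 3)" if "S \<in> gap_sets r" for S r
    using size[OF that, of 2] notin(1)[OF that] by (simp add: sum_shift card_shift)
  have weight_h: "\<Sum>(?h S) = \<Sum>S + (4 * r + 4)" if "S \<in> gap_sets r" for S r
    using size[OF that, of 4] notin(4)[OF that] by (simp add: sum_shift card_shift)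
  have "finite {x \<in> gap_sets r. \<Sum>x = n} \<and> card {x \<in> gap_sets r. \<Sum>x = n} = rec_count r n"
    by (rule card_level_eq_rec_count[where w = "\<lambda>S. \<Sum>S", OF base _ step disj_fg disj_fh disj_gh
          inj_f inj_g inj_h weight_f weight_g weight_h]) simp
  then show ?thesis by blast
qed

text \<open>
  Here the smallest non-overlined part plays the role of the smallest part above, and the
  alternative between the parts 3 and 4 becomes the presence of the largest overlined part that is
  permitted at level \<open>r + 1\<close> but not at level \<open>r\<close>, namely \<open>2 * r + 1\<close>.
\<close>

lemma card_odd_pairs: "card {(N, V) \<in> odd_pairs r. \<Sum>N + \<Sum>V = n} = rec_count r n"
proof -
  let ?w = "\<lambda>P :: nat set \<times> nat set. \<Sum>(fst P) + \<Sum>(snd P)"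
  let ?f = "\<lambda>P. (shift 2 (fst P), snd P)"
    and ?g = "\<lambda>P. (insert 3 (shift 2 (fst P)), snd P)"
    and ?h = "\<lambda>r P. (insert 3 (shift 2 (fst P)), insert (2 * r + 1) (snd P))"
  \<comment> \<open>Both forms of \<open>2 * r + 1\<close> occur below, the second as its simp normal form.\<close>
  have notin: "3 \<notin> shift 2 (fst P)" "2 * r + 1 \<notin> snd P" "Suc (2 * r) \<notin> snd P" "finite (snd P)"
    if "P \<in> odd_pairs r" for P r
  proof -
    show "3 \<notin> shift 2 (fst P)" "2 * r + 1 \<notin> snd P" "Suc (2 * r) \<notin> snd P"
      using that by (fastforce simp: odd_pairs_def mem_shift)+
    have "snd P \<subseteq> {..<2 * r}" using that by (auto simp: odd_pairs_def)
    then show "finite (snd P)" by (rule finite_subset) simp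
  qed
  have shifted: "finite (shift 2 (fst P))" "card (shift 2 (fst P)) = r"
    "\<forall>x\<in>shift 2 (fst P). odd x \<and> 3 \<le> x" "\<forall>x\<in>snd P. odd x \<and> x < 2 * r"
    if "P \<in> odd_pairs r" for P r
  proof -
    obtain N V where P: "P = (N, V)" by fastforce
    have "finite N" "card N = r" and N: "\<forall>x\<in>N. odd x \<and> 3 \<le> x" and V: "V \<subseteq> {x. odd x \<and> x < 2 * r}"
      using that by (simp_all add: P odd_pairs_def)
    then show "finite (shift 2 (fst P))" "card (shift 2 (fst P)) = r"
      by (simp_all add: P card_shift finite_shift_iff)
    show "\<forall>x\<in>shift 2 (fst P). odd x \<and> 3 \<le> x"
      using N by (force simp: P shift_def)
    show "\<forall>x\<in>snd P. odd x \<and> x < 2 * r"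
      using V by (auto simp: P)
  qed
  have f_mem: "?f P \<in> odd_pairs r" if "P \<in> odd_pairs r" for P r
    using shifted[OF that] by (auto simp: odd_pairs_def)
  have g_mem: "?g P \<in> odd_pairs (Suc r)" and h_mem: "?h r P \<in> odd_pairs (Suc r)"
    if "P \<in> odd_pairs r" for P r
  proof -
    have "snd P \<subseteq> {x. odd x \<and> x < 2 * Suc r}"
      using shifted(4)[OF that] by fastforce
    then show "?g P \<in> odd_pairs (Suc r)" "?h r P \<in> odd_pairs (Suc r)"
      using shifted(1-3)[OF that] notin(1)[OF that] by (simp_all add: odd_pairs_def)
  qed
  have decompose: "P \<in> ?f ` odd_pairs (Suc r) \<union> ?g ` odd_pairs r \<union> ?h r ` odd_pairs r"
    if P: "P \<in> odd_pairs (Suc r)" for P r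
  proof -
    obtain N V where PNV: "P = (N, V)" by fastforce
    have N: "finite N" "card N = Suc r" "\<And>x. x \<in> N \<Longrightarrow> odd x \<and> 3 \<le> x"
      and V: "\<And>x. x \<in> V \<Longrightarrow> odd x \<and> x < 2 * r + 2"
      using P by (auto simp: PNV odd_pairs_def)
    have "N - {3} \<subseteq> {2 + 3..}"
    proof
      fix x assume x: "x \<in> N - {3}"
      then have "x \<noteq> 4" using N(3)[of 4] by auto
      then show "x \<in> {2 + 3..}" using N(3)[of x] x by auto
    qed
    moreover from this obtain T where T: "N - {3} = shift 2 T"
      using shift_exists[of "N - {3}" 2] by fastforce
    ultimately have T': "odd x \<and> 3 \<le> x" if "x \<in> T" for x
    proof -
      have "2 + x \<in> N - {3}" unfolding T using that by (simp add: mem_shift)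
      then show ?thesis using N(3)[of "2 + x"] \<open>N - {3} \<subseteq> {2 + 3..}\<close> by auto
    qed
    have finT: "finite T" using N(1) finite_shift_iff[of 2 T] by (simp flip: T)
    have crd: "card T = card (N - {3})" by (simp add: T card_shift)
    show ?thesis
    proof (cases "3 \<in> N")
      case False
      then have "(T, V) \<in> odd_pairs (Suc r)"
        using T' finT crd N V by (auto simp: odd_pairs_def)
      moreover have "P = ?f (T, V)" using False T PNV by auto
      ultimately show ?thesis by blast
    next
      case True
      have r: "(T, V - {2 * r + 1}) \<in> odd_pairs r"
      proof -
        have "odd x \<and> x < 2 * r" if "x \<in> V - {2 * r + 1}" for x
          using V[of x] that by (auto simp: less_Suc_eq)
        then show ?thesis using T' finT crd N True by (auto simp: odd_pairs_def)
      qed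
      have NT: "N = insert 3 (shift 2 T)" using True T by auto
      show ?thesis
      proof (cases "2 * r + 1 \<in> V")
        case True
        then have "P = ?h r (T, V - {2 * r + 1})" using NT PNV by auto
        then show ?thesis using r by blast
      next
        case False
        then have "P = ?g (T, V - {2 * r + 1})" using NT PNV by auto
        then show ?thesis using r by blast
      qed
    qed
  qed
  have "P = ({}, {})" if "P \<in> odd_pairs 0" for P
  proof -
    obtain N V where P: "P = (N, V)" by fastforce
    have "finite N" "card N = 0" "V \<subseteq> {x. odd x \<and> x < 0}"
      using that by (simp_all add: P odd_pairs_def)
    then show ?thesis by (simp add: P)
  qed
  moreover have "({}, {}) \<in> odd_pairs 0"
    by (simp add: odd_pairs_def)
  ultimately have base: "odd_pairs 0 = {({}, {})}"
    by blast
  have step: "odd_pairs (Suc r) = ?f ` odd_pairs (Suc r) \<union> ?g ` odd_pairs r \<union> ?h r ` odd_pairs r" for r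
    by (intro equalityI subsetI decompose Un_least image_subsetI f_mem g_mem h_mem)
  have disj_fg: "?f ` odd_pairs (Suc r) \<inter> ?g ` odd_pairs r = {}" for r
    using notin by force
  have disj_fh: "?f ` odd_pairs (Suc r) \<inter> ?h r ` odd_pairs r = {}" for r
    using notin by force
  have disj_gh: "?g ` odd_pairs r \<inter> ?h r ` odd_pairs r = {}" for r
    using notin by force
  have inj_f: "inj_on ?f (odd_pairs r)" for r
    by (auto simp: inj_on_def shift_eq_iff)
  have inj_g: "inj_on ?g (odd_pairs r)" for r
  proof (rule inj_onI)
    fix P Q assume *: "P \<in> odd_pairs r" "Q \<in> odd_pairs r" "?g P = ?g Q"
    then have "shift 2 (fst P) = shift 2 (fst Q)" "snd P = snd Q"
      using notin(1,2)[OF *(1)] notin(1,2)[OF *(2)]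
      by (simp_all only: prod.inject insert_ident not_False_eq_True)
    then show "P = Q" by (simp add: shift_eq_iff prod_eq_iff)
  qed
  have inj_h: "inj_on (?h r) (odd_pairs r)" for r
  proof (rule inj_onI)
    fix P Q assume *: "P \<in> odd_pairs r" "Q \<in> odd_pairs r" "?h r P = ?h r Q"
    then have "shift 2 (fst P) = shift 2 (fst Q)" "snd P = snd Q"
      using notin(1,2)[OF *(1)] notin(1,2)[OF *(2)]
      by (simp_all only: prod.inject insert_ident not_False_eq_True)
    then show "P = Q" by (simp add: shift_eq_iff prod_eq_iff)
  qed
  have weight_f: "?w (?f P) = ?w P + (2 * r + 2)" if "P \<in> odd_pairs (Suc r)" for P r
    using shifted(2)[OF that] by (simp add: sum_shift card_shift)
  have weight_g: "?w (?g P) = ?w P + (2 * r + 3)" if "P \<in> odd_pairs r" for P r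
    using shifted(1,2)[OF that] notin(1)[OF that] by (simp add: sum_shift card_shift)
  have weight_h: "?w (?h r P) = ?w P + (4 * r + 4)" if "P \<in> odd_pairs r" for P r
    using shifted(1,2)[OF that] notin[OF that] by (simp add: sum_shift card_shift)
  have "finite {x \<in> odd_pairs r. ?w x = n} \<and> card {x \<in> odd_pairs r. ?w x = n} = rec_count r n"
    by (rule card_level_eq_rec_count[where w = "?w", OF base _ step disj_fg disj_fh disj_gh
          inj_f inj_g inj_h weight_f weight_g weight_h]) simp
  moreover have "{(N, V) \<in> odd_pairs r. \<Sum>N + \<Sum>V = n} = {P \<in> odd_pairs r. ?w P = n}"
    by auto
  ultimately show ?thesis by simp
qed

section \<open>From sorted lists to sets\<close>

lemma sorted_wrt_key_iff:
  fixes key :: "'a \<Rightarrow> nat"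
  shows "sorted_wrt (\<lambda>p q. key q < key p) ps \<longleftrightarrow> sorted_wrt (<) (rev (map key ps))"
  by (simp add: sorted_wrt_rev sorted_wrt_map)

lemma decreasing_list_unique:
  fixes key :: "'a \<Rightarrow> nat"
  assumes "inj key" "set ps = set qs"
    "sorted_wrt (\<lambda>p q. key q < key p) ps" "sorted_wrt (\<lambda>p q. key q < key p) qs"
  shows "ps = qs"
proof -
  have "rev (map key ps) = rev (map key qs)"
    using assms unfolding sorted_wrt_key_iff by (intro strict_sorted_equal) auto
  then show ?thesis
    using assms(1) by (simp add: inj_map_eq_map)
qed

lemma decreasing_list_exists:
  fixes key :: "'a \<Rightarrow> nat"
  assumes "finite P" "inj key"
  obtains ps where "sorted_wrt (\<lambda>p q. key q < key p) ps" "set ps = P"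
proof -
  let ?ks = "rev (sorted_list_of_set (key ` P))"
  have "map key (map (inv key) ?ks) = ?ks"
    using assms by (auto simp: inv_f_f intro!: map_idI)
  then have "sorted_wrt (\<lambda>p q. key q < key p) (map (inv key) ?ks)"
    by (simp only: sorted_wrt_key_iff) simp
  moreover have "set (map (inv key) ?ks) = P"
    using assms by (simp add: image_image inv_f_f)
  ultimately show ?thesis by (rule that)
qed

text \<open>
  In a strictly decreasing list the gap condition on positions is a condition on the set of parts:
  it says that no two parts are consecutive. Membership in \<open>gap_sets\<close> at the length of the list
  also encodes that the parts are distinct.
\<close>

lemma GG2_partitions_iff:
  "xs \<in> GG2_partitions n \<longleftrightarrow>
     sorted_wrt (>) xs \<and> set xs \<in> gap_sets (length xs) \<and> \<Sum>(set xs) = n"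
proof -
  have sorted: "sorted_wrt (>) xs \<longleftrightarrow> sorted_wrt (\<ge>) xs \<and> distinct xs"
    by (induction xs) (auto simp: order_le_less)
  have sum: "sum_list xs = \<Sum>(set xs)" if "distinct xs"
    using that by (simp add: distinct_sum_list_conv_Sum)
  have apart: "(\<forall>i<length xs. \<forall>j<length xs. i \<noteq> j \<longrightarrow> \<bar>int (xs ! i) - int (xs ! j)\<bar> \<ge> 2) \<longleftrightarrow>
      distinct xs \<and> (\<forall>x\<in>set xs. x + 1 \<notin> set xs)" (is "?L \<longleftrightarrow> ?R")
  proof
    assume L: ?L
    then have "distinct xs" by (fastforce simp: distinct_conv_nth)
    moreover have False if "x \<in> set xs" "x + 1 \<in> set xs" for x
    proof -
      obtain i j where "i < length xs" "xs ! i = x" "j < length xs" "xs ! j = x + 1"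
        using \<open>x \<in> set xs\<close> \<open>x + 1 \<in> set xs\<close> by (metis in_set_conv_nth)
      then show False using L[rule_format, of i j] by (cases "i = j") auto
    qed
    ultimately show ?R by blast
  next
    assume R: ?R
    show ?L
    proof (intro allI impI)
      fix i j assume ij: "i < length xs" "j < length xs" "i \<noteq> j"
      then have "xs ! i \<noteq> xs ! j" using R by (simp add: nth_eq_iff_index_eq)
      moreover have "xs ! i + 1 \<noteq> xs ! j" "xs ! j + 1 \<noteq> xs ! i"
        using R ij by (metis nth_mem)+
      ultimately show "\<bar>int (xs ! i) - int (xs ! j)\<bar> \<ge> 2" by linarith
    qed
  qed
  have evens: "(\<exists>s::int. 2 * s \<in> int ` set xs \<and> 2 * s - 2 \<in> int ` set xs) \<longleftrightarrow>
      (\<exists>x\<in>set xs. even x \<and> x + 2 \<in> set xs)" (is "?L \<longleftrightarrow> ?R")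
  proof
    assume ?L
    then obtain s x y where "x \<in> set xs" "y \<in> set xs" "2 * s = int y" "2 * s - 2 = int x" by auto
    moreover from this have "y = x + 2" "even x" by presburger+
    ultimately show ?R by auto
  next
    assume ?R
    then obtain k where "2 * k \<in> set xs" "2 * k + 2 \<in> set xs" by (auto elim!: evenE)
    then show ?L by (intro exI[of _ "int k + 1"]) (force simp: image_iff)
  qed
  have len: "card (set xs) = length xs \<longleftrightarrow> distinct xs"
    using distinct_card card_distinct by blast
  have "xs \<in> GG2_partitions n \<longleftrightarrow> sorted_wrt (\<ge>) xs \<and> distinct xs \<and> sum_list xs = n \<and>
      (\<forall>x\<in>set xs. 0 < x) \<and> (\<forall>x\<in>set xs. 3 \<le> x \<and> x + 1 \<notin> set xs \<and> (even x \<longrightarrow> x + 2 \<notin> set xs))"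
    unfolding GG2_partitions_def is_partition_def mem_Collect_eq apart evens by blast
  also have "\<dots> \<longleftrightarrow> sorted_wrt (>) xs \<and> set xs \<in> gap_sets (length xs) \<and> \<Sum>(set xs) = n"
    unfolding gap_sets_def mem_Collect_eq len sorted using sum by fastforce
  finally show ?thesis .
qed

lemma card_GG2_partitions_length:
  "card {xs \<in> GG2_partitions n. length xs = r} = rec_count r n"
proof -
  have "bij_betw set {xs \<in> GG2_partitions n. length xs = r} {S \<in> gap_sets r. \<Sum>S = n}"
  proof (rule bij_betw_imageI)
    show "inj_on set {xs \<in> GG2_partitions n. length xs = r}"
      by (rule inj_onI, rule decreasing_list_unique[of "\<lambda>x. x"]) (auto simp: GG2_partitions_iff)
    show "set ` {xs \<in> GG2_partitions n. length xs = r} = {S \<in> gap_sets r. \<Sum>S = n}"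
    proof (intro equalityI subsetI)
      fix S assume S: "S \<in> {S \<in> gap_sets r. \<Sum>S = n}"
      then have "finite S" "card S = r" by (auto simp: gap_sets_def)
      then obtain xs where xs: "sorted_wrt (>) xs" "set xs = S"
        using decreasing_list_exists[of S "\<lambda>x. x"] by auto
      then have "length xs = r"
        using \<open>card S = r\<close> distinct_card[of xs] strict_sorted_iff[of "rev xs"]
        by (simp add: sorted_wrt_rev)
      then show "S \<in> set ` {xs \<in> GG2_partitions n. length xs = r}"
        using xs S by (auto simp: GG2_partitions_iff)
    qed (auto simp: GG2_partitions_iff)
  qed
  then show ?thesis
    by (simp add: bij_betw_same_card card_gap_sets)
qed

text \<open>
  The overlined part of a given magnitude comes last, so it gets the smaller key. Overpartitions
  with distinct non-overlined parts thereby become the lists with strictly decreasing keys.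
\<close>

definition part_key :: "nat \<times> bool \<Rightarrow> nat" where
  "part_key p = 2 * fst p + (if snd p then 0 else 1)"

lemma inj_part_key: "inj part_key"
  by (auto simp: inj_def part_key_def split: if_splits) presburger+

text \<open>
  For two entries of equal magnitude the rule on overlining forbids that the earlier one is
  overlined, and distinctness forbids that both are non-overlined. Only the order of decreasing keys
  remains, so the three conditions on pairs of positions merge into one.
\<close>

lemma overpartition_iff_sorted_part_key:
  "is_overpartition n ps \<and> distinct (non_overlined ps) \<longleftrightarrow>
     sorted_wrt (\<lambda>p q. part_key q < part_key p) ps \<and> (\<forall>p\<in>set ps. 0 < fst p) \<and>
     sum_list (map fst ps) = n"
proof -
  have nov: "distinct (non_overlined ps) \<longleftrightarrow>
      sorted_wrt (\<lambda>p q. \<not> snd p \<and> \<not> snd q \<longrightarrow> fst q \<noteq> fst p) ps"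
    by (induction ps) (auto simp: non_overlined_def image_iff)
  have ov: "(\<forall>i<length ps. snd (ps ! i) \<longrightarrow>
        (\<forall>j. i < j \<and> j < length ps \<longrightarrow> fst (ps ! j) \<noteq> fst (ps ! i))) \<longleftrightarrow>
      sorted_wrt (\<lambda>p q. snd p \<longrightarrow> fst q \<noteq> fst p) ps"
    by (auto simp: sorted_wrt_iff_nth_less)
  have "part_key q < part_key p \<longleftrightarrow> fst q \<le> fst p \<and> (snd p \<longrightarrow> fst q \<noteq> fst p) \<and>
      (\<not> snd p \<and> \<not> snd q \<longrightarrow> fst q \<noteq> fst p)" for p q
    by (auto simp: part_key_def)
  then have key: "sorted_wrt (\<lambda>p q. part_key q < part_key p) ps \<longleftrightarrow>
      sorted_wrt (\<lambda>p q. fst q \<le> fst p) ps \<and> sorted_wrt (\<lambda>p q. snd p \<longrightarrow> fst q \<noteq> fst p) ps \<and>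
      sorted_wrt (\<lambda>p q. \<not> snd p \<and> \<not> snd q \<longrightarrow> fst q \<noteq> fst p) ps"
    by (induction ps) auto
  show ?thesis
    unfolding is_overpartition_def is_partition_def ov nov key sorted_wrt_map by auto
qed

lemma set_non_overlined: "set (non_overlined ps) = {k. (k, False) \<in> set ps}"
  by (force simp: non_overlined_def)

lemma set_overlined: "set (overlined ps) = {k. (k, True) \<in> set ps}"
  by (force simp: overlined_def)

lemma distinct_if_sorted_part_key:
  assumes "sorted_wrt (\<lambda>p q. part_key q < part_key p) ps"
  shows "distinct (non_overlined ps)" "distinct (overlined ps)"
  using assms by (induction ps) (auto simp: non_overlined_def overlined_def part_key_def)

lemma GG2_overpartitions_iff:
  "ps \<in> GG2_overpartitions n \<longleftrightarrow>
     sorted_wrt (\<lambda>p q. part_key q < part_key p) ps \<and>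
     (set (non_overlined ps), set (overlined ps)) \<in> odd_pairs (length (non_overlined ps)) \<and>
     \<Sum>(set (non_overlined ps)) + \<Sum>(set (overlined ps)) = n"
proof (cases "sorted_wrt (\<lambda>p q. part_key q < part_key p) ps")
  case True
  note d = distinct_if_sorted_part_key[OF this]
  have "sum_list (map fst ps) = sum_list (non_overlined ps) + sum_list (overlined ps)"
    by (induction ps) (auto simp: non_overlined_def overlined_def)
  then have s: "sum_list (map fst ps) = \<Sum>(set (non_overlined ps)) + \<Sum>(set (overlined ps))"
    using d by (simp add: distinct_sum_list_conv_Sum)
  have pos: "(\<forall>p\<in>set ps. 0 < fst p) \<longleftrightarrow>
      (\<forall>x\<in>set (non_overlined ps). 0 < x) \<and> (\<forall>x\<in>set (overlined ps). 0 < x)"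
    by (force simp: non_overlined_def overlined_def)
  have o1: "odd x \<and> 1 < x \<longleftrightarrow> odd x \<and> 3 \<le> x" for x :: nat by presburger
  have o2: "odd x \<and> int x \<le> 2 * int m - 1 \<longleftrightarrow> odd x \<and> x < 2 * m" for x m :: nat by presburger
  have "ps \<in> GG2_overpartitions n \<longleftrightarrow>
     (is_overpartition n ps \<and> distinct (non_overlined ps)) \<and>
     (\<forall>x\<in>set (non_overlined ps). odd x \<and> 3 \<le> x) \<and>
     (\<forall>x\<in>set (overlined ps). odd x \<and> x < 2 * length (non_overlined ps))"
    unfolding GG2_overpartitions_def o1 o2 by blast
  also have "\<dots> \<longleftrightarrow> (set (non_overlined ps), set (overlined ps)) \<in> odd_pairs (length (non_overlined ps)) \<and>
     \<Sum>(set (non_overlined ps)) + \<Sum>(set (overlined ps)) = n"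
    unfolding overpartition_iff_sorted_part_key pos s
    using True distinct_card[OF d(1)] by (fastforce simp: odd_pairs_def intro: odd_pos)
  finally show ?thesis using True by blast
next
  case False
  then show ?thesis
    using overpartition_iff_sorted_part_key[of n ps] by (auto simp: GG2_overpartitions_def)
qed

lemma card_GG2_overpartitions_length:
  "card {ps \<in> GG2_overpartitions n. length (non_overlined ps) = r} = rec_count r n"
proof -
  let ?A = "{ps \<in> GG2_overpartitions n. length (non_overlined ps) = r}"
  let ?\<pi> = "\<lambda>ps. (set (non_overlined ps), set (overlined ps))"
  have "bij_betw ?\<pi> ?A {(N, V) \<in> odd_pairs r. \<Sum>N + \<Sum>V = n}"
  proof (rule bij_betw_imageI)
    show "inj_on ?\<pi> ?A"
    proof (rule inj_onI)
      fix ps qs assume *: "ps \<in> ?A" "qs \<in> ?A" "?\<pi> ps = ?\<pi> qs"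
      have "p \<in> set ps \<longleftrightarrow> p \<in> set qs" for p
        using *(3) by (cases p; cases "snd p") (auto simp: set_non_overlined set_overlined)
      then have "set ps = set qs" by blast
      then show "ps = qs"
        using * by (intro decreasing_list_unique[OF inj_part_key]) (auto simp: GG2_overpartitions_iff)
    qed
    show "?\<pi> ` ?A = {(N, V) \<in> odd_pairs r. \<Sum>N + \<Sum>V = n}"
    proof (intro equalityI subsetI)
      fix P assume P: "P \<in> {(N, V) \<in> odd_pairs r. \<Sum>N + \<Sum>V = n}"
      then obtain N V where NV: "P = (N, V)" "(N, V) \<in> odd_pairs r" "\<Sum>N + \<Sum>V = n" by auto
      then have "finite N" "card N = r" "V \<subseteq> {..<2 * r}" by (auto simp: odd_pairs_def)
      then have "finite (N \<times> {False} \<union> V \<times> {True})" by (auto intro: finite_subset)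
      then obtain ps where ps: "sorted_wrt (\<lambda>p q. part_key q < part_key p) ps"
        "set ps = N \<times> {False} \<union> V \<times> {True}"
        using decreasing_list_exists[OF _ inj_part_key] by metis
      have sets: "set (non_overlined ps) = N" "set (overlined ps) = V"
        by (auto simp: set_non_overlined set_overlined ps(2))
      have "distinct (non_overlined ps)"
        by (rule distinct_if_sorted_part_key[OF ps(1)])
      then have len: "length (non_overlined ps) = r"
        by (simp only: distinct_card[symmetric] sets \<open>card N = r\<close>)
      have "ps \<in> ?A" "?\<pi> ps = P"
        using ps(1) NV by (simp_all add: GG2_overpartitions_iff len sets)
      then show "P \<in> ?\<pi> ` ?A" by blast
    qed (auto simp: GG2_overpartitions_iff)
  qed
  then show ?thesis
    by (simp add: bij_betw_same_card card_odd_pairs)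
qed

section \<open>Summation over the number of parts\<close>

lemma card_eq_sum_fibres:
  assumes "finite A" "\<And>x. x \<in> A \<Longrightarrow> m x \<le> (n::nat)"
  shows "card A = (\<Sum>r\<le>n. card {x \<in> A. m x = r})"
proof -
  have "(\<Sum>r\<le>n. \<Sum>x\<in>{x \<in> A. m x = r}. 1) = (\<Sum>x\<in>A. 1 :: nat)"
    by (rule sum.group) (use assms in auto)
  then show ?thesis by simp
qed

theorem theorem4p3:
  fixes n :: nat
  shows "GG2 n = GG2_bar n"
proof -
  have "GG2 n = (\<Sum>r\<le>n. card {xs \<in> GG2_partitions n. length xs = r})"
    unfolding GG2_def
    by (rule card_eq_sum_fibres[OF finite_GG2_partitions])
       (auto simp: GG2_partitions_def intro: partition_bounds)
  also have "\<dots> = (\<Sum>r\<le>n. card {ps \<in> GG2_overpartitions n. length (non_overlined ps) = r})"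
    by (simp add: card_GG2_partitions_length card_GG2_overpartitions_length)
  also have "\<dots> = GG2_bar n"
    unfolding GG2_bar_def
  proof (rule card_eq_sum_fibres[OF finite_GG2_overpartitions, symmetric])
    fix ps assume "ps \<in> GG2_overpartitions n"
    then have "length (map fst ps) \<le> n"
      by (intro partition_bounds) (simp add: GG2_overpartitions_def is_overpartition_def)
    then show "length (non_overlined ps) \<le> n"
      using order_trans[OF length_filter_le[of "\<lambda>p. \<not> snd p" ps], of n] by (simp add: non_overlined_def)
  qed
  finally show ?thesis .
qed

end
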